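(* Let $\mathbb{F}$ be a field with $\mathrm{Char}(\mathbb{F})=3$ in which every quadratic and every cubic polynomial has a root. Nontrivial two-dimensional algebras over $\mathbb{F}$ are distributed with respect to the number of their nontrivial (that is, one-dimensional) subalgebras as follows (families $A_{1,3},\dots,A_{12,3}$ as in the context; parameters range over $\mathbb{F}$). (1) Any nontrivial two-dimensional algebra with only one nontrivial subalgebra is isomorphic to one of: - $A_{2,3}(\alpha_1,\beta_1,2\alpha_1-1)$; - $A_{3,3}(\beta_1,-1)$, where $\beta_1\neq0$; - $A_{5,3}(\alpha_1)$; - $A_{9,3}$; - $A_{11,3}$; - $A_{12,3}$. (2) Any nontrivial two-dimensional algebra with exactly two nontrivial subalgebras is isomorphic to one of: - $A_{1,3}(\alpha_1,\alpha_2,\alpha_4,-\alpha_4-1)$; - $A_{3,3}(\beta_1,\beta_2)$, where $\beta_2\neq-1$; - $A_{4,3}(\alpha_1,\beta_2)$, where $2\alpha_1-\beta_2-1\neq0$; - $A_{7,3}(\beta_1)$; - $A_{8,3}(\alpha_1)$. (3) Any nontrivial two-dimensional algebra with exactly three nontrivial subalgebras is isomorphic to one of: - $A_{1,3}(\alpha_1,\alpha_2,\alpha_4,\beta_1)$, where $\alpha_4(\beta_1+\alpha_4+1)\neq0$; - $A_{1,3}(\alpha_1,\alpha_2,0,\beta_1)$, where $\beta_1\neq-1$; - $A_{2,3}(\alpha_1,\beta_1,\beta_2)$, where $\beta_2\neq2\alpha_1-1$; - $A_{6,3}(\alpha_1,\beta_1)$. (4) Any nontrivial two-dimensional algebra with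 infinitely many nontrivial subalgebras is isomorphic to one of: - $A_{3,3}(0,-1)$; - $A_{4,3}(\alpha_1,2\alpha_1-1)$; - $A_{10,3}$.
   Context: An algebra is a vector space with a bilinear product (not necessarily associative, commutative or unital); it is nontrivial if its product is not identically zero. A nontrivial subalgebra of a two-dimensional algebra is a one-dimensional one. A two-dimensional algebra with basis $e_1,e_2$ is identified with its matrix of structure constants (MSC) $A=\begin{pmatrix}\alpha_1&\alpha_2&\alpha_3&\alpha_4\\ \beta_1&\beta_2&\beta_3&\beta_4\end{pmatrix}$, meaning $e_1e_1=\alpha_1e_1+\beta_1e_2$, $e_1e_2=\alpha_2e_1+\beta_2e_2$, $e_2e_1=\alpha_3e_1+\beta_3e_2$, $e_2e_2=\alpha_4e_1+\beta_4e_2$. Families ($\mathrm{Char}(\mathbb{F})=3$): $A_{1,3}(\alpha_1,\alpha_2,\alpha_4,\beta_1)=\begin{pmatrix}\alpha_1&\alpha_2&\alpha_2+1&\alpha_4\\ \beta_1&-\alpha_1&-\alpha_1+1&-\alpha_2\end{pmatrix}$, $A_{2,3}(\alpha_1,\beta_1,\beta_2)=\begin{pmatrix}\alpha_1&0&0&1\\ \beta_1&\beta_2&1-\alpha_1&0\end{pmatrix}$, $A_{3,3}(\beta_1,\beta_2)=\begin{pmatrix}0&1&1&0\\ \beta_1&\beta_2&1&-1\end{pmatrix}$, $A_{4,3}(\alpha_1,\beta_2)=\begin{pmatrix}\alpha_1&0&0&0\\ 0&\beta_2&1-\alpha_1&0\end{pmatrix}$, $A_{5,3}(\alpha_1)=\begin{pmatrix}\alpha_1&0&0&0\\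 1&-1-\alpha_1&1-\alpha_1&0\end{pmatrix}$, $A_{6,3}(\alpha_1,\beta_1)=\begin{pmatrix}\alpha_1&0&0&1\\ \beta_1&1-\alpha_1&-\alpha_1&0\end{pmatrix}$, $A_{7,3}(\beta_1)=\begin{pmatrix}0&1&1&0\\ \beta_1&1&0&-1\end{pmatrix}$, $A_{8,3}(\alpha_1)=\begin{pmatrix}\alpha_1&0&0&0\\ 0&1-\alpha_1&-\alpha_1&0\end{pmatrix}$, $A_{9,3}=\begin{pmatrix}0&1&1&0\\ 1&0&0&-1\end{pmatrix}$, $A_{10,3}=\begin{pmatrix}0&1&1&0\\ 0&0&0&-1\end{pmatrix}$, $A_{11,3}=\begin{pmatrix}1&0&0&0\\ 1&-1&-1&0\end{pmatrix}$, $A_{12,3}=\begin{pmatrix}0&0&0&0\\ 1&0&0&0\end{pmatrix}$. *)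

theory Defs
  imports "HOL-Analysis.Analysis" "HOL-Computational_Algebra.Computational_Algebra"
begin

text \<open>The library dimension of an infinite-dimensional space is 0, so dimension 2 below implies
  finite-dimensionality.\<close>

definition two_dim_algebra ::
  "('a::field \<Rightarrow> 'v::ab_group_add \<Rightarrow> 'v) \<Rightarrow> ('v \<Rightarrow> 'v \<Rightarrow> 'v) \<Rightarrow> bool" where
  "two_dim_algebra smul mul \<longleftrightarrow>
     vector_space smul \<and> vector_space.dim smul UNIV = 2 \<and>
     (\<forall>u. Vector_Spaces.linear smul smul (\<lambda>v. mul u v)) \<and>
     (\<forall>v. Vector_Spaces.linear smul smul (\<lambda>u. mul u v))"

definition nontrivial_algebra :: "('v::ab_group_add \<Rightarrow> 'v \<Rightarrow> 'v) \<Rightarrow> bool" where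
  "nontrivial_algebra mul \<longleftrightarrow> (\<exists>u v. mul u v \<noteq> 0)"

definition one_dim_subalgebras ::
  "('a::field \<Rightarrow> 'v::ab_group_add \<Rightarrow> 'v) \<Rightarrow> ('v \<Rightarrow> 'v \<Rightarrow> 'v) \<Rightarrow> 'v set set" where
  "one_dim_subalgebras smul mul =
     {S. module.subspace smul S \<and> vector_space.dim smul S = 1 \<and>
         (\<forall>u\<in>S. \<forall>v\<in>S. mul u v \<in> S)}"

definition algebra_isomorphic ::
  "('a::field \<Rightarrow> 'v::ab_group_add \<Rightarrow> 'v) \<Rightarrow> ('v \<Rightarrow> 'v \<Rightarrow> 'v) \<Rightarrow>
   ('a \<Rightarrow> 'w::ab_group_add \<Rightarrow> 'w) \<Rightarrow> ('w \<Rightarrow> 'w \<Rightarrow> 'w) \<Rightarrow> bool" where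
  "algebra_isomorphic smul mul smul' mul' \<longleftrightarrow>
     (\<exists>f. Vector_Spaces.linear smul smul' f \<and> bij f \<and>
          (\<forall>u v. f (mul u v) = mul' (f u) (f v)))"

text \<open>The columns of a matrix of structure constants are the coordinates of
  $e_1e_1$, $e_1e_2$, $e_2e_1$, $e_2e_2$, in this order, so the product of two coordinate
  vectors is the matrix applied to their Kronecker product.\<close>

definition msc_mult :: "'a::field^4^2 \<Rightarrow> 'a^2 \<Rightarrow> 'a^2 \<Rightarrow> 'a^2" where
  "msc_mult A u v = A *v vector [u$1 * v$1, u$1 * v$2, u$2 * v$1, u$2 * v$2]"

definition msc :: "'a::field \<Rightarrow> 'a \<Rightarrow> 'a \<Rightarrow> 'a \<Rightarrow> 'a \<Rightarrow> 'a \<Rightarrow> 'a \<Rightarrow> 'a \<Rightarrow> 'a^4^2" where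
  "msc a1 a2 a3 a4 b1 b2 b3 b4 = vector [vector [a1, a2, a3, a4], vector [b1, b2, b3, b4]]"

lemma vector_4:
  "(vector [x, y, z, w] :: 'a::zero^4) $ 1 = x"
  "(vector [x, y, z, w] :: 'a::zero^4) $ 2 = y"
  "(vector [x, y, z, w] :: 'a::zero^4) $ 3 = z"
  "(vector [x, y, z, w] :: 'a::zero^4) $ 4 = w"
  unfolding vector_def by simp_all

lemma msc_mult_basis:
  fixes a1 a2 a3 a4 b1 b2 b3 b4 :: "'a::field"
  defines "A \<equiv> msc a1 a2 a3 a4 b1 b2 b3 b4"
  shows "msc_mult A (axis 1 1) (axis 1 1) = a1 *s axis 1 1 + b1 *s axis 2 1"
    and "msc_mult A (axis 1 1) (axis 2 1) = a2 *s axis 1 1 + b2 *s axis 2 1"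
    and "msc_mult A (axis 2 1) (axis 1 1) = a3 *s axis 1 1 + b3 *s axis 2 1"
    and "msc_mult A (axis 2 1) (axis 2 1) = a4 *s axis 1 1 + b4 *s axis 2 1"
  by (simp_all add: A_def msc_def msc_mult_def vec_eq_iff forall_2 matrix_vector_mult_def
      sum_4 axis_def vector_4)

text \<open>An algebra is identified with the matrix of its structure constants through the choice
  of a basis, so being isomorphic to a matrix means being isomorphic to the algebra it
  defines on coordinate vectors.\<close>

definition isomorphic_to_msc ::
  "('a::field \<Rightarrow> 'v::ab_group_add \<Rightarrow> 'v) \<Rightarrow> ('v \<Rightarrow> 'v \<Rightarrow> 'v) \<Rightarrow> 'a^4^2 \<Rightarrow> bool" where
  "isomorphic_to_msc smul mul A \<longleftrightarrow> algebra_isomorphic smul mul (*s) (msc_mult A)"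

definition A1_3 :: "'a::field \<Rightarrow> 'a \<Rightarrow> 'a \<Rightarrow> 'a \<Rightarrow> 'a^4^2" where
  "A1_3 a1 a2 a4 b1 = msc a1 a2 (a2 + 1) a4  b1 (- a1) (- a1 + 1) (- a2)"

definition A2_3 :: "'a::field \<Rightarrow> 'a \<Rightarrow> 'a \<Rightarrow> 'a^4^2" where
  "A2_3 a1 b1 b2 = msc a1 0 0 1  b1 b2 (1 - a1) 0"

definition A3_3 :: "'a::field \<Rightarrow> 'a \<Rightarrow> 'a^4^2" where
  "A3_3 b1 b2 = msc 0 1 1 0  b1 b2 1 (- 1)"

definition A4_3 :: "'a::field \<Rightarrow> 'a \<Rightarrow> 'a^4^2" where
  "A4_3 a1 b2 = msc a1 0 0 0  0 b2 (1 - a1) 0"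

definition A5_3 :: "'a::field \<Rightarrow> 'a^4^2" where
  "A5_3 a1 = msc a1 0 0 0  1 (- 1 - a1) (1 - a1) 0"

definition A6_3 :: "'a::field \<Rightarrow> 'a \<Rightarrow> 'a^4^2" where
  "A6_3 a1 b1 = msc a1 0 0 1  b1 (1 - a1) (- a1) 0"

definition A7_3 :: "'a::field \<Rightarrow> 'a^4^2" where
  "A7_3 b1 = msc 0 1 1 0  b1 1 0 (- 1)"

definition A8_3 :: "'a::field \<Rightarrow> 'a^4^2" where
  "A8_3 a1 = msc a1 0 0 0  0 (1 - a1) (- a1) 0"

definition A9_3 :: "'a::field^4^2" where
  "A9_3 = msc 0 1 1 0  1 0 0 (- 1)"

definition A10_3 :: "'a::field^4^2" where
  "A10_3 = msc 0 1 1 0  0 0 0 (- 1)"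

definition A11_3 :: "'a::field^4^2" where
  "A11_3 = msc 1 0 0 0  1 (- 1) (- 1) 0"

definition A12_3 :: "'a::field^4^2" where
  "A12_3 = msc 0 0 0 0  1 0 0 0"

end

theory Submission
  imports Defs
begin

text \<open>A line is a subalgebra iff its slope is a root of a binary cubic form in which only
  $\beta_1$, $\alpha_1 - \beta_2 - \beta_3$, $\alpha_2 + \alpha_3 - \beta_4$ and $\alpha_4$ enter, so
  counting subalgebras is counting projective roots. The traces of right and of left multiplication
  are two linear forms on the algebra. If they are independent, the dual basis gives the family
  $A_{1,3}$; otherwise a basis with $e_2$ in their common kernel leaves only rescalings and shifts
  $e_1 \mapsto e_1 + k e_2$, which bring the structure constants into one of the other families.\<close>

unbundle no Formal_Power_Series.fps_syntax

section \<open>Subalgebras as projective roots\<close>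

text \<open>The characteristic acts through the cubic form. If \<open>e2\<close> lies in the kernel
  of both trace forms, then \<open>a2 = a3 = - b4\<close>, so the quadratic coefficient is
  \<open>3 * a2 = 0\<close> and the linear one is \<open>3 * a1 - (x + y) = - (x + y)\<close>, where
  \<open>x\<close> and \<open>y\<close> are the traces of right and left multiplication by
  \<open>e1\<close>. What remains is \<open>a4 * t^3 - (x + y) * t - b1\<close>, whose number of
  projective roots depends only on which of \<open>a4\<close>, \<open>x + y\<close> and
  \<open>b1\<close> vanish. Conditions such as \<open>b2 = 2 * a1 - 1\<close> are
  \<open>x + y = 0\<close> in disguise; there, for nonzero \<open>a4\<close>, the form is a multiple
  of a cube and has a single root. The four items are equivalences, yet it is never decided which
  members of the families are isomorphic: every parameter range forces its own count, the ranges
  exhaust all algebras, and different counts exclude one another. The hypothesis on quadratics has a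
  second use besides splitting: it forces the field to be infinite, so that the zero form has
  infinitely many roots.\<close>

lemma one_dim_subalgebras_eq_spans:
  fixes smul :: "'a::field \<Rightarrow> 'v::ab_group_add \<Rightarrow> 'v"
  assumes "vector_space smul"
    and bilin: "\<And>c d v. mul (smul c v) (smul d v) = smul (c * d) (mul v v)"
  shows "one_dim_subalgebras smul mul =
    {module.span smul {v} |v. v \<noteq> 0 \<and> mul v v \<in> module.span smul {v}}"
proof -
  interpret vector_space smul by fact
  have "\<exists>v. S = span {v} \<and> v \<noteq> 0 \<and> mul v v \<in> span {v}"
    if S: "subspace S" "dim S = 1" "\<forall>u\<in>S. \<forall>v\<in>S. mul u v \<in> S" for S
  proof -
    obtain B where B: "B \<subseteq> S" "independent B" "S \<subseteq> span B" "card B = dim S"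
      using basis_exists by blast
    with S obtain v where v: "B = {v}"
      by (metis card_1_singletonE)
    have "S = span {v}"
      using B S v by (metis span_minimal subset_antisym)
    moreover have "v \<noteq> 0"
      using B v dependent_zero by blast
    ultimately show ?thesis
      using S B v by blast
  qed
  moreover have "dim (span {v}) = 1" if "v \<noteq> 0" for v
    using that dim_span_eq_card_independent[of "{v}"] by (simp add: dim_span)
  \<comment> \<open>On a line every product is a multiple of \<open>mul v v\<close>, so closure is a
    condition on one square.\<close>
  moreover have "mul u w \<in> span {v}" if "mul v v \<in> span {v}" "u \<in> span {v}" "w \<in> span {v}" for u v w
    using that bilin by (auto simp: span_singleton)
  ultimately show ?thesis
    unfolding one_dim_subalgebras_def by (auto simp: subspace_span)
qed

lemma msc_component:
  "(msc a1 a2 a3 a4 b1 b2 b3 b4 $ 1) $ 1 = a1" "(msc a1 a2 a3 a4 b1 b2 b3 b4 $ 1) $ 2 = a2"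
  "(msc a1 a2 a3 a4 b1 b2 b3 b4 $ 1) $ 3 = a3" "(msc a1 a2 a3 a4 b1 b2 b3 b4 $ 1) $ 4 = a4"
  "(msc a1 a2 a3 a4 b1 b2 b3 b4 $ 2) $ 1 = b1" "(msc a1 a2 a3 a4 b1 b2 b3 b4 $ 2) $ 2 = b2"
  "(msc a1 a2 a3 a4 b1 b2 b3 b4 $ 2) $ 3 = b3" "(msc a1 a2 a3 a4 b1 b2 b3 b4 $ 2) $ 4 = b4"
  by (simp_all add: msc_def vector_4)

lemma msc_mult_component:
  "msc_mult (msc a1 a2 a3 a4 b1 b2 b3 b4) u v $ 1 =
     a1 * (u$1 * v$1) + a2 * (u$1 * v$2) + a3 * (u$2 * v$1) + a4 * (u$2 * v$2)"
  "msc_mult (msc a1 a2 a3 a4 b1 b2 b3 b4) u v $ 2 =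
     b1 * (u$1 * v$1) + b2 * (u$1 * v$2) + b3 * (u$2 * v$1) + b4 * (u$2 * v$2)"
  by (simp_all add: msc_mult_def matrix_vector_mult_def sum_4 vector_4 msc_component)

text \<open>Isomorphisms commute with spans, so the description by spanning vectors carries over. A
  bijection is needed rather than an equality of cardinalities, because infiniteness has to be
  transported as well.\<close>

lemma bij_betw_one_dim_subalgebras:
  fixes smul :: "'a::field \<Rightarrow> 'v::ab_group_add \<Rightarrow> 'v"
    and smul' :: "'a \<Rightarrow> 'w::ab_group_add \<Rightarrow> 'w"
  assumes f: "Vector_Spaces.linear smul smul' f" "bij f"
    and hom: "\<And>u v. f (mul u v) = mul' (f u) (f v)"
    and bilin: "\<And>c d v. mul (smul c v) (smul d v) = smul (c * d) (mul v v)"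
  shows "bij_betw ((`) f) (one_dim_subalgebras smul mul) (one_dim_subalgebras smul' mul')"
proof -
  interpret Vector_Spaces.linear smul smul' f by fact
  note vs = vs1.vector_space_axioms vs2.vector_space_axioms
  have inj: "f u = f v \<longleftrightarrow> u = v" for u v
    using f(2) by (metis bij_pointE)
  have bilin': "mul' (smul' c w) (smul' d w) = smul' (c * d) (mul' w w)" for c d w
    by (metis (no_types, lifting) bij_pointE bilin f(2) hom scale)
  have img: "f ` vs1.span {v} = vs2.span {f v}" for v
    using span_image[of "{v}"] by simp
  have mem: "f u \<in> vs2.span {f v} \<longleftrightarrow> u \<in> vs1.span {v}" for u v
    unfolding img[symmetric] using inj by (auto simp: image_iff)
  have zero: "f v = 0 \<longleftrightarrow> v = 0" for v
    using inj[of v 0] by (simp add: zero)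
  have "(`) f ` one_dim_subalgebras smul mul = one_dim_subalgebras smul' mul'"
    unfolding one_dim_subalgebras_eq_spans[of smul mul, OF vs(1) bilin]
      one_dim_subalgebras_eq_spans[of smul' mul', OF vs(2) bilin']
  proof (intro equalityI subsetI)
    fix S assume "S \<in> (`) f ` {vs1.span {v} |v. v \<noteq> 0 \<and> mul v v \<in> vs1.span {v}}"
    then obtain v where "S = f ` vs1.span {v}" "v \<noteq> 0" "mul v v \<in> vs1.span {v}"
      by blast
    then show "S \<in> {vs2.span {v} |v. v \<noteq> 0 \<and> mul' v v \<in> vs2.span {v}}"
      using mem[of "mul v v" v] img[of v] zero[of v] hom[of v v] by auto
  next
    fix S assume "S \<in> {vs2.span {v} |v. v \<noteq> 0 \<and> mul' v v \<in> vs2.span {v}}"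
    then obtain w where w: "S = vs2.span {w}" "w \<noteq> 0" "mul' w w \<in> vs2.span {w}"
      by blast
    obtain v where "w = f v"
      using f(2) by (metis bij_pointE)
    then have "S = f ` vs1.span {v}" "v \<noteq> 0" "mul v v \<in> vs1.span {v}"
      using w mem[of "mul v v" v] img[of v] zero[of v] hom[of v v] by auto
    then show "S \<in> (`) f ` {vs1.span {v} |v. v \<noteq> 0 \<and> mul v v \<in> vs1.span {v}}"
      by blast
  qed
  moreover have "inj_on ((`) f) (one_dim_subalgebras smul mul)"
    using f(2) by (meson bij_is_inj inj_image_eq_iff inj_onI)
  ultimately show ?thesis
    by (simp add: bij_betw_def)
qed

text \<open>The roots on the projective line of the homogenized cubic, where \<^term>\<open>None\<close> is the
  point at infinity.\<close>

definition projective_roots :: "'a::field \<Rightarrow> 'a \<Rightarrow> 'a \<Rightarrow> 'a \<Rightarrow> 'a option set" where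
  "projective_roots c0 c1 c2 c3 =
     Some ` {t. c0 + c1 * t + c2 * t^2 + c3 * t^3 = 0} \<union> (if c3 = 0 then {None} else {})"

text \<open>Proportionality in the plane is the vanishing of a determinant; this is what turns
  closure of a line into a polynomial equation.\<close>

lemma mem_span_singleton_2:
  fixes v w :: "'a::field^2"
  assumes "v \<noteq> 0"
  shows "w \<in> vec.span {v} \<longleftrightarrow> v$1 * w$2 = v$2 * w$1"
proof
  assume "w \<in> vec.span {v}"
  then show "v$1 * w$2 = v$2 * w$1"
    by (auto simp: vec.span_singleton)
next
  assume eq: "v$1 * w$2 = v$2 * w$1"
  consider "v$1 \<noteq> 0" | "v$2 \<noteq> 0"
    using assms by (auto simp: vec_eq_iff forall_2)
  then have "\<exists>k. w = k *s v"
  proof cases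
    case 1
    with eq have "w = (w$1 / v$1) *s v"
      by (simp add: vec_eq_iff forall_2 field_simps)
    then show ?thesis ..
  next
    case 2
    with eq have "w = (w$2 / v$2) *s v"
      by (simp add: vec_eq_iff forall_2 field_simps)
    then show ?thesis ..
  qed
  then show "w \<in> vec.span {v}"
    by (auto simp: vec.span_singleton)
qed

text \<open>The determinant of \<open>v\<close> and \<open>mul v v\<close> is a binary cubic form in
  the coordinates of \<open>v\<close>. On \<open>vector [1, t]\<close> its vanishing is the cubic
  equation in the slope \<open>t\<close>; on \<open>vector [0, 1]\<close> it is
  \<open>a4 = 0\<close>, the condition for the point at infinity.\<close>

lemma bij_betw_projective_roots:
  fixes a1 a2 a3 a4 b1 b2 b3 b4 :: "'a::field"
  defines "mul \<equiv> msc_mult (msc a1 a2 a3 a4 b1 b2 b3 b4)"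
  shows "\<exists>h. bij_betw h (projective_roots (- b1) (a1 - b2 - b3) (a2 + a3 - b4) a4)
    (one_dim_subalgebras (*s) mul)"
proof -
  define p where "p = (\<lambda>z. case z of None \<Rightarrow> vector [0, 1] | Some t \<Rightarrow> (vector [1, t] :: 'a^2))"
  have p1: "p (Some t) $ 1 = 1" "p (Some t) $ 2 = t" for t
    by (simp_all add: p_def)
  have p2: "p None $ 1 = 0" "p None $ 2 = 1"
    by (simp_all add: p_def)
  have nz: "p z \<noteq> 0" for z
    by (cases z) (auto simp: vec_eq_iff forall_2 p1 p2)
  have sub: "one_dim_subalgebras (*s) mul =
      {vec.span {v} |v. v \<noteq> 0 \<and> mul v v \<in> vec.span {v}}"
    by (rule one_dim_subalgebras_eq_spans)
      (simp_all add: vec.vector_space_axioms mul_def vec_eq_iff forall_2 msc_mult_component algebra_simps)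
  have mem: "mul (p z) (p z) \<in> vec.span {p z} \<longleftrightarrow>
      z \<in> projective_roots (- b1) (a1 - b2 - b3) (a2 + a3 - b4) a4" for z
  proof (cases z)
    case None
    then show ?thesis
      by (auto simp: mem_span_singleton_2 nz projective_roots_def mul_def msc_mult_component p2)
  next
    case (Some t)
    have "b1 + b2 * t + b3 * t + b4 * (t * t) = t * (a1 + a2 * t + a3 * t + a4 * (t * t)) \<longleftrightarrow>
        - b1 + (a1 - b2 - b3) * t + (a2 + a3 - b4) * t^2 + a4 * t^3 = 0"
      by algebra
    with Some show ?thesis
      by (auto simp: mem_span_singleton_2 nz projective_roots_def mul_def msc_mult_component p1)
  qed
  have line: "\<exists>z. vec.span {v} = vec.span {p z}" if "v \<noteq> 0" for v
  proof -
    define z where "z = (if v$1 = 0 then None else Some (v$2 / v$1))"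
    have "\<exists>k. k \<noteq> 0 \<and> v = k *s p z"
    proof (cases "v$1 = 0")
      case True
      with that have "v$2 \<noteq> 0" "v = (v$2) *s p z"
        by (auto simp: vec_eq_iff forall_2 z_def p2)
      then show ?thesis by blast
    next
      case False
      then have "v = (v$1) *s p z"
        by (simp add: vec_eq_iff forall_2 z_def p1)
      with False show ?thesis by blast
    qed
    then have "vec.span {v} = vec.span {p z}"
      using vec.span_image_scale[of "{p z}" "\<lambda>_. _"] by fastforce
    then show ?thesis ..
  qed
  have "bij_betw (\<lambda>z. vec.span {p z}) (projective_roots (- b1) (a1 - b2 - b3) (a2 + a3 - b4) a4)
      (one_dim_subalgebras (*s) mul)"
    unfolding bij_betw_def
  proof
    show "inj_on (\<lambda>z. vec.span {p z}) (projective_roots (- b1) (a1 - b2 - b3) (a2 + a3 - b4) a4)"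
    proof (rule inj_onI)
      fix y z assume "vec.span {p y} = vec.span {p z}"
      then have "p y \<in> vec.span {p z}"
        using vec.span_base[of "p y" "{p y}"] by simp
      then show "y = z"
        by (cases y; cases z) (auto simp: mem_span_singleton_2 nz p1 p2)
    qed
    show "(\<lambda>z. vec.span {p z}) ` projective_roots (- b1) (a1 - b2 - b3) (a2 + a3 - b4) a4 =
        one_dim_subalgebras (*s) mul"
    proof (intro equalityI subsetI)
      fix S assume "S \<in> (\<lambda>z. vec.span {p z}) ` projective_roots (- b1) (a1 - b2 - b3) (a2 + a3 - b4) a4"
      then show "S \<in> one_dim_subalgebras (*s) mul"
        unfolding sub using mem nz by blast
    next
      fix S assume S: "S \<in> one_dim_subalgebras (*s) mul"
      then obtain v where v: "v \<noteq> 0" "S = vec.span {v}"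
        unfolding sub by blast
      then obtain z where z: "S = vec.span {p z}"
        using line by metis
      have "p z \<in> S"
        using z vec.span_base[of "p z" "{p z}"] by simp
      then have "mul (p z) (p z) \<in> S"
        using S by (simp add: one_dim_subalgebras_def)
      then show "S \<in> (\<lambda>z. vec.span {p z}) ` projective_roots (- b1) (a1 - b2 - b3) (a2 + a3 - b4) a4"
        using z mem by blast
    qed
  qed
  then show ?thesis by blast
qed

lemma subalgebras_of_msc:
  fixes smul :: "'a::field \<Rightarrow> 'v::ab_group_add \<Rightarrow> 'v"
  assumes alg: "two_dim_algebra smul mul"
    and iso: "isomorphic_to_msc smul mul (msc a1 a2 a3 a4 b1 b2 b3 b4)"
  shows "\<exists>h. bij_betw h (one_dim_subalgebras smul mul)
    (projective_roots (- b1) (a1 - b2 - b3) (a2 + a3 - b4) a4)"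
proof -
  obtain f where f: "Vector_Spaces.linear smul (*s) f" "bij f"
      "\<And>u v. f (mul u v) = msc_mult (msc a1 a2 a3 a4 b1 b2 b3 b4) (f u) (f v)"
    using iso unfolding isomorphic_to_msc_def algebra_isomorphic_def by blast
  interpret vector_space smul
    using alg by (simp add: two_dim_algebra_def)
  have "mul (smul c v) (smul d v) = smul (c * d) (mul v v)" for c d v
    using alg by (simp add: two_dim_algebra_def Vector_Spaces.linear_iff)
  with f have "bij_betw ((`) f) (one_dim_subalgebras smul mul)
      (one_dim_subalgebras (*s) (msc_mult (msc a1 a2 a3 a4 b1 b2 b3 b4)))"
    by (intro bij_betw_one_dim_subalgebras[of smul "(*s)" f]) auto
  then show ?thesis
    using bij_betw_projective_roots[of b1 a1 b2 b3 a2 a3 b4 a4]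
    by (metis bij_betw_inv bij_betw_trans)
qed

section \<open>Change of basis\<close>

lemma ex_isomorphic_msc:
  fixes smul :: "'a::field \<Rightarrow> 'v::ab_group_add \<Rightarrow> 'v"
  assumes alg: "two_dim_algebra smul mul"
  shows "\<exists>a1 a2 a3 a4 b1 b2 b3 b4. isomorphic_to_msc smul mul (msc a1 a2 a3 a4 b1 b2 b3 b4)"
proof -
  interpret vector_space smul
    using alg by (simp add: two_dim_algebra_def)
  have lin: "Vector_Spaces.linear smul smul (\<lambda>v. mul u v)"
      "Vector_Spaces.linear smul smul (\<lambda>v. mul v u)" for u
    using alg by (simp_all add: two_dim_algebra_def)
  have bilin: "mul (u + v) w = mul u w + mul v w" "mul w (u + v) = mul w u + mul w v"
      "mul (smul c u) w = smul c (mul u w)" "mul w (smul c u) = smul c (mul w u)" for u v w c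
    using lin by (simp_all add: Vector_Spaces.linear_iff)
  obtain B where B: "independent B" "UNIV \<subseteq> span B" "card B = 2"
    using basis_exists[of UNIV] alg by (metis two_dim_algebra_def)
  then obtain e1 e2 where e: "B = {e1, e2}" "e1 \<noteq> e2"
    by (meson card_2_iff)
  \<comment> \<open>The map from coordinates to vectors comes first, since there products expand by
    bilinearity; the isomorphism required is its inverse.\<close>
  define g where "g = (\<lambda>u::'a^2. smul (u$1) e1 + smul (u$2) e2)"
  have surj: "\<exists>u. v = g u" for v
  proof -
    obtain x where "v - smul x e1 \<in> span {e2}"
      using B(2) e span_breakdown_eq[of v e1 "{e2}"] by blast
    then obtain y where "v - smul x e1 = smul y e2"
      by (auto simp: span_singleton)
    then have "v = g (vector [x, y])"
      by (simp add: g_def algebra_simps)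
    then show ?thesis ..
  qed
  have ind: "e2 \<noteq> 0" "e1 \<notin> span {e2}"
    using B(1) e by (auto simp: independent_insert)
  have gadd: "g (u + v) = g u + g v" for u v
    by (simp add: g_def algebra_simps)
  have gscale: "g (c *s u) = smul c (g u)" for c u
    by (simp add: g_def algebra_simps)
  have gdiff: "g (u - v) = g u - g v" for u v
    by (simp add: g_def algebra_simps)
  have ker: "u = 0" if "g u = 0" for u
  proof -
    have eq: "smul (u$1) e1 = smul (- (u$2)) e2"
      using that by (simp add: g_def add_eq_0_iff)
    have "u$1 = 0"
    proof (rule ccontr)
      assume "u$1 \<noteq> 0"
      then have "e1 = smul (inverse (u$1)) (smul (u$1) e1)"
        by simp
      then have "e1 \<in> span {e2}"
        unfolding eq using span_base[of e2 "{e2}"] span_scale by (metis singletonI)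
      with ind show False by blast
    qed
    with eq ind show ?thesis
      by (simp add: vec_eq_iff forall_2)
  qed
  have inj: "inj g"
    by (rule injI) (metis gdiff ker right_minus_eq)
  then have bij: "bij g"
    using surj by (metis bijI surjI surj_def)
  define f where "f = inv g"
  have fg: "f (g u) = u" "g (f v) = v" for u v
    using bij by (simp_all add: f_def bij_is_inj bij_is_surj surj_f_inv_f)
  obtain a1 b1 a2 b2 a3 b3 a4 b4 where m:
      "mul e1 e1 = smul a1 e1 + smul b1 e2" "mul e1 e2 = smul a2 e1 + smul b2 e2"
      "mul e2 e1 = smul a3 e1 + smul b3 e2" "mul e2 e2 = smul a4 e1 + smul b4 e2"
    using surj unfolding g_def by metis
  have gmul: "g (msc_mult (msc a1 a2 a3 a4 b1 b2 b3 b4) u v) = mul (g u) (g v)" for u v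
    by (simp add: g_def msc_mult_component bilin m scale_left_distrib scale_right_distrib
        algebra_simps)
  have "Vector_Spaces.linear smul (*s) f"
    unfolding Vector_Spaces.linear_iff
    by (metis fg gadd gscale vec.vector_space_axioms vector_space_axioms)
  moreover have "bij f"
    using bij by (simp add: f_def bij_imp_bij_inv)
  moreover have "f (mul u v) = msc_mult (msc a1 a2 a3 a4 b1 b2 b3 b4) (f u) (f v)" for u v
    by (metis fg gmul)
  ultimately show ?thesis
    unfolding isomorphic_to_msc_def algebra_isomorphic_def by blast
qed

text \<open>\<open>g\<close> sends old coordinates to new ones, so its matrix is inverse to the one
  expressing the new basis in the old. This explains the reciprocals and the sign of
  \<open>- k\<close> in the instances below.\<close>

lemma isomorphic_to_msc_change_basis:
  fixes p q r s :: "'a::field"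
  defines "g \<equiv> \<lambda>u :: 'a^2. vector [p * u$1 + q * u$2, r * u$1 + s * u$2] :: 'a^2"
  assumes iso: "isomorphic_to_msc smul mul A"
    and det: "p * s - q * r \<noteq> 0"
    and hom: "\<And>u v. g (msc_mult A u v) = msc_mult B (g u) (g v)"
  shows "isomorphic_to_msc smul mul B"
proof -
  obtain f where f: "Vector_Spaces.linear smul (*s) f" "bij f"
      "\<And>u v. f (mul u v) = msc_mult A (f u) (f v)"
    using iso unfolding isomorphic_to_msc_def algebra_isomorphic_def by blast
  have "Vector_Spaces.linear ((*s) :: 'a \<Rightarrow> 'a^2 \<Rightarrow> 'a^2) (*s) g"
    unfolding Vector_Spaces.linear_iff
    by (simp add: g_def vec.vector_space_axioms vec_eq_iff forall_2 algebra_simps)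
  from Vector_Spaces.linear_compose[OF f(1) this] have "Vector_Spaces.linear smul (*s) (g \<circ> f)" .
  moreover have "bij g"
  proof (rule o_bij)
    define d where "d = inverse (p * s - q * r)"
    have d: "d * (p * s - q * r) = 1"
      using det by (simp add: d_def)
    \<comment> \<open>The inverse is the adjugate matrix divided by the determinant.\<close>
    define h where
      "h = (\<lambda>u :: 'a^2. vector [d * (s * u$1 - q * u$2), d * (p * u$2 - r * u$1)] :: 'a^2)"
    have "d * (s * (p * x + q * y) - q * (r * x + s * y)) = d * (p * s - q * r) * x"
      "d * (p * (r * x + s * y) - r * (p * x + q * y)) = d * (p * s - q * r) * y"
      "p * (d * (s * x - q * y)) + q * (d * (p * y - r * x)) = d * (p * s - q * r) * x"
      "r * (d * (s * x - q * y)) + s * (d * (p * y - r * x)) = d * (p * s - q * r) * y" for x y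
      by (simp_all add: algebra_simps)
    then show "h \<circ> g = id" "g \<circ> h = id"
      by (simp_all add: fun_eq_iff vec_eq_iff forall_2 g_def h_def d)
  qed
  then have "bij (g \<circ> f)"
    by (rule bij_comp[OF f(2)])
  moreover have "(g \<circ> f) (mul u v) = msc_mult B ((g \<circ> f) u) ((g \<circ> f) v)" for u v
    by (simp add: f(3) hom)
  ultimately show ?thesis
    unfolding isomorphic_to_msc_def algebra_isomorphic_def by blast
qed

text \<open>The new basis is \<open>c * e1\<close>, \<open>d * e2\<close>.\<close>

lemma isomorphic_to_msc_scale:
  assumes "isomorphic_to_msc smul mul (msc a1 a2 a3 a4 b1 b2 b3 b4)" and "c \<noteq> 0" "d \<noteq> 0"
  shows "isomorphic_to_msc smul mul (msc (c * a1) (d * a2) (d * a3) (d^2 / c * a4)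
    (c^2 / d * b1) (c * b2) (c * b3) (d * b4))"
  using assms
  by (intro isomorphic_to_msc_change_basis[OF assms(1), where p = "1/c" and q = 0 and r = 0 and s = "1/d"])
    (simp_all add: vec_eq_iff forall_2 msc_mult_component distrib_left power2_eq_square)

text \<open>The new basis is \<open>e1 + k * e2\<close>, \<open>e2\<close>. As \<open>e2\<close> is
  kept, \<open>a4\<close> does not change, and whether it vanishes can steer the reductions.\<close>

lemma isomorphic_to_msc_shift:
  fixes k :: "'a::field"
  assumes "isomorphic_to_msc smul mul (msc a1 a2 a3 a4 b1 b2 b3 b4)"
  defines "a1' \<equiv> a1 + k * (a2 + a3) + k^2 * a4"
  shows "isomorphic_to_msc smul mul (msc a1' (a2 + k * a4) (a3 + k * a4) a4
    (b1 + k * (b2 + b3) + k^2 * b4 - k * a1') (b2 + k * b4 - k * (a2 + k * a4))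
    (b3 + k * b4 - k * (a3 + k * a4)) (b4 - k * a4))"
  unfolding a1'_def
  by (intro isomorphic_to_msc_change_basis[OF assms(1), where p = 1 and q = 0 and r = "- k" and s = 1])
    (simp_all add: vec_eq_iff forall_2 msc_mult_component algebra_simps power2_eq_square)

lemma isomorphic_to_msc_swap:
  assumes "isomorphic_to_msc smul mul (msc a1 a2 a3 a4 b1 b2 b3 b4)"
  shows "isomorphic_to_msc smul mul (msc b4 b3 b2 b1 a4 a3 a2 a1)"
  by (intro isomorphic_to_msc_change_basis[OF assms, where p = 0 and q = 1 and r = 1 and s = 0])
    (simp_all add: vec_eq_iff forall_2 msc_mult_component algebra_simps)

section \<open>Numbers of projective roots\<close>

text \<open>On a finite field \<open>x^2 - x\<close> is not injective, since 0 and 1 have the same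
  image, hence not surjective; a missed value \<open>c\<close> gives the quadratic
  \<open>x^2 - x - c\<close> without a root.\<close>

lemma infinite_UNIV_if_quadratic_roots:
  assumes quadratic: "\<forall>p :: 'a::field poly. degree p = 2 \<longrightarrow> (\<exists>x. poly p x = 0)"
  shows "infinite (UNIV :: 'a set)"
proof
  assume fin: "finite (UNIV :: 'a set)"
  define f :: "'a \<Rightarrow> 'a" where "f = (\<lambda>x. x^2 - x)"
  have "f 0 = f 1"
    by (simp add: f_def)
  then have "\<not> inj f"
    by (metis injD zero_neq_one)
  with fin have "\<not> surj f"
    using finite_UNIV_surj_inj by blast
  then obtain c where c: "c \<noteq> f x" for x
    by (metis surjI)
  obtain x where "poly [:- c, - 1, 1:] x = 0"
    using quadratic[rule_format, of "[:- c, - 1, 1:]"] by auto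
  then have "c = f x"
    by (simp add: f_def power2_eq_square algebra_simps)
  with c show False
    by blast
qed

text \<open>Vieta's formulas are used in place of a factorization, so that substituting the
  coefficients makes every later factorization a polynomial identity.\<close>

lemma quadratic_splits:
  fixes c0 c1 c2 :: "'a::field"
  assumes quadratic: "\<forall>p :: 'a poly. degree p = 2 \<longrightarrow> (\<exists>x. poly p x = 0)"
    and "c2 \<noteq> 0"
  shows "\<exists>r s. c1 = - c2 * (r + s) \<and> c0 = c2 * r * s"
proof -
  obtain r where r: "poly [:c0, c1, c2:] r = 0"
    using quadratic[rule_format, of "[:c0, c1, c2:]"] assms by auto
  define s where "s = - c1 / c2 - r"
  have "c1 = - c2 * (r + s)"
    using assms by (simp add: s_def)
  moreover from this r have "c0 = c2 * r * s"
    by simp algebra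
  ultimately show ?thesis
    by blast
qed

lemma cubic_splits:
  fixes c0 c1 c2 c3 :: "'a::field"
  assumes quadratic: "\<forall>p :: 'a poly. degree p = 2 \<longrightarrow> (\<exists>x. poly p x = 0)"
    and cubic: "\<forall>p :: 'a poly. degree p = 3 \<longrightarrow> (\<exists>x. poly p x = 0)"
    and "c3 \<noteq> 0"
  shows "\<exists>r s w. c2 = - c3 * (r + s + w) \<and> c1 = c3 * (r * s + r * w + s * w) \<and>
    c0 = - c3 * r * s * w"
proof -
  obtain r where r: "poly [:c0, c1, c2, c3:] r = 0"
    using cubic[rule_format, of "[:c0, c1, c2, c3:]"] assms by auto
  \<comment> \<open>The left-hand sides are the lower coefficients of the quotient by
    \<open>t - r\<close>, as synthetic division gives them.\<close>
  obtain s w where sw: "c2 + c3 * r = - c3 * (s + w)" "c1 + c2 * r + c3 * r^2 = c3 * s * w"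
    using quadratic_splits[OF quadratic \<open>c3 \<noteq> 0\<close>] by metis
  have "c2 = - c3 * (r + s + w)"
    using sw(1) by algebra
  moreover have "c1 = c3 * (r * s + r * w + s * w)"
    using sw by algebra
  moreover have "c0 = - c3 * r * s * w"
    using sw r by simp algebra
  ultimately show ?thesis
    by blast
qed

text \<open>A split binary cubic form has three roots with multiplicity. The derivative condition
  excludes multiple affine roots, and \<open>deg\<close> excludes a multiple root at
  infinity.\<close>

lemma card_projective_roots_separable:
  fixes c0 c1 c2 c3 :: "'a::field"
  assumes quadratic: "\<forall>p :: 'a poly. degree p = 2 \<longrightarrow> (\<exists>x. poly p x = 0)"
    and cubic: "\<forall>p :: 'a poly. degree p = 3 \<longrightarrow> (\<exists>x. poly p x = 0)"
    and deg: "c2 \<noteq> 0 \<or> c3 \<noteq> 0"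
    and separable: "\<And>t. c0 + c1 * t + c2 * t^2 + c3 * t^3 = 0 \<Longrightarrow> c1 + 2 * c2 * t + 3 * c3 * t^2 \<noteq> 0"
  shows "card (projective_roots c0 c1 c2 c3) = 3"
proof (cases "c3 = 0")
  case False
  obtain r s w where eq: "c2 = - c3 * (r + s + w)" "c1 = c3 * (r * s + r * w + s * w)"
      "c0 = - c3 * r * s * w"
    using cubic_splits[OF quadratic cubic False] by blast
  have fac: "c0 + c1 * t + c2 * t^2 + c3 * t^3 = c3 * ((t - r) * (t - s) * (t - w))" for t
    unfolding eq by algebra
  have der: "c1 + 2 * c2 * t + 3 * c3 * t^2 =
      c3 * ((t - r) * (t - s) + (t - r) * (t - w) + (t - s) * (t - w))" for t
    unfolding eq by algebra
  \<comment> \<open>At \<open>r\<close> the derivative is \<open>c3 * (r - s) * (r - w)\<close>, at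
    \<open>s\<close> it is \<open>c3 * (s - r) * (s - w)\<close>, so these two points separate all
    three roots.\<close>
  have "r \<noteq> s" "r \<noteq> w" "s \<noteq> w"
    using separable[of r] separable[of s] unfolding fac der by auto
  moreover have "{t. c0 + c1 * t + c2 * t^2 + c3 * t^3 = 0} = {r, s, w}"
    unfolding fac using False by auto
  ultimately show ?thesis
    using False by (simp add: projective_roots_def)
next
  case True
  with deg have "c2 \<noteq> 0"
    by simp
  then obtain r s where eq: "c1 = - c2 * (r + s)" "c0 = c2 * r * s"
    using quadratic_splits[OF quadratic] by metis
  have fac: "c0 + c1 * t + c2 * t^2 + c3 * t^3 = c2 * ((t - r) * (t - s))" for t
    unfolding eq True by algebra
  have der: "c1 + 2 * c2 * t + 3 * c3 * t^2 = c2 * ((t - r) + (t - s))" for t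
    unfolding eq True by algebra
  have "r \<noteq> s"
    using separable[of r] unfolding fac der by auto
  moreover have "{t. c0 + c1 * t + c2 * t^2 + c3 * t^3 = 0} = {r, s}"
    unfolding fac using \<open>c2 \<noteq> 0\<close> by auto
  ultimately show ?thesis
    using True by (simp add: projective_roots_def)
qed

text \<open>The point at infinity is always a root here and adds one to the affine count; for the
  zero form every point is a root.\<close>

lemma projective_roots_linear:
  fixes c0 c1 :: "'a::field"
  shows "c1 \<noteq> 0 \<Longrightarrow> card (projective_roots c0 c1 0 0) = 2"
    and "c0 \<noteq> 0 \<Longrightarrow> card (projective_roots c0 0 0 0) = 1"
    and "infinite (UNIV :: 'a set) \<Longrightarrow> infinite (projective_roots (0::'a) 0 0 0)"
proof -
  assume "c1 \<noteq> 0"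
  then have "{t. c0 + c1 * t = 0} = {- c0 / c1}"
    by (auto simp: field_simps add_eq_0_iff)
  then show "card (projective_roots c0 c1 0 0) = 2"
    by (simp add: projective_roots_def)
next
  show "infinite (UNIV :: 'a set) \<Longrightarrow> infinite (projective_roots (0::'a) 0 0 0)"
    by (auto simp: projective_roots_def dest: finite_imageD)
qed (simp add: projective_roots_def)

text \<open>Cubing is additive in characteristic 3, so \<open>c0 + t^3\<close> is the cube of a
  linear polynomial.\<close>

lemma card_projective_roots_cube:
  fixes c0 :: "'a::field"
  assumes three: "(3::'a) = 0"
    and cubic: "\<forall>p :: 'a poly. degree p = 3 \<longrightarrow> (\<exists>x. poly p x = 0)"
  shows "card (projective_roots c0 0 0 1) = 1"
proof -
  obtain r where "poly [:c0, 0, 0, 1:] r = 0"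
    using cubic[rule_format, of "[:c0, 0, 0, 1:]"] by auto
  then have r: "c0 = - (r^3)"
    by (simp add: power3_eq_cube add_eq_0_iff2)
  have "(t - r)^3 = t^3 - r^3 - 3 * (t^2 * r - t * r^2)" for t
    by algebra
  then have "c0 + t^3 = (t - r)^3" for t
    by (simp add: r three)
  then have "{t. c0 + t^3 = 0} = {r}"
    by auto
  then show ?thesis
    by (simp add: projective_roots_def)
qed

text \<open>Modulo 3 the derivative of \<open>a4 * t^3 + t^2 - t - b1\<close> is
  \<open>- (t + 1)\<close>, so only \<open>- 1\<close> can be a multiple root. The value there is
  \<open>- (b1 + a4 + 1)\<close>, which explains the condition.\<close>

lemma card_projective_roots_A1_3:
  fixes a4 b1 :: "'a::field"
  assumes three: "(3::'a) = 0"
    and quadratic: "\<forall>p :: 'a poly. degree p = 2 \<longrightarrow> (\<exists>x. poly p x = 0)"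
    and cubic: "\<forall>p :: 'a poly. degree p = 3 \<longrightarrow> (\<exists>x. poly p x = 0)"
  shows "card (projective_roots (- b1) (- 1) 1 a4) = (if b1 = - a4 - 1 then 2 else 3)"
proof (cases "b1 = - a4 - 1")
  case True
  \<comment> \<open>An identity valid in every characteristic; the part that vanishes in
    characteristic 3 is kept apart as an explicit multiple of 3.\<close>
  have "- b1 + - 1 * t + 1 * t^2 + a4 * t^3 = (t + 1)^2 * (a4 * t + (a4 + 1)) - 3 * (a4 * t^2 + (a4 + 1) * t)" for t
    unfolding True by algebra
  then have fac: "- b1 + - 1 * t + 1 * t^2 + a4 * t^3 = (t + 1)^2 * (a4 * t + (a4 + 1))" for t
    by (simp add: three)
  show ?thesis
  proof (cases "a4 = 0")
    case a4: True
    \<comment> \<open>The simple root has moved to infinity, so the count is still two.\<close>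
    have "{t. - b1 + - 1 * t + 1 * t^2 + a4 * t^3 = 0} = {- 1}"
      unfolding fac using a4 by (auto simp: add_eq_0_iff2)
    then show ?thesis
      using True a4 by (simp add: projective_roots_def)
  next
    case a4: False
    have "a4 * t + (a4 + 1) = 0 \<longleftrightarrow> t = - (a4 + 1) / a4" for t
      using a4 by (auto simp: field_simps add_eq_0_iff)
    then have "{t. - b1 + - 1 * t + 1 * t^2 + a4 * t^3 = 0} = {- 1, - (a4 + 1) / a4}"
      unfolding fac by (auto simp: add_eq_0_iff2)
    moreover have "- 1 \<noteq> - (a4 + 1) / a4"
      using a4 by (simp add: field_simps)
    ultimately show ?thesis
      using True a4 by (simp add: projective_roots_def)
  qed
next
  case False
  have "t = - 1" if "- 1 + 2 * 1 * t + 3 * a4 * t^2 = 0" for t :: 'a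
  proof -
    have "t + 1 = 3 * (t + a4 * t^2) - (- 1 + 2 * 1 * t + 3 * a4 * t^2)"
      by algebra
    also have "\<dots> = 3 * (t + a4 * t^2)"
      unfolding that by simp
    also have "\<dots> = 0"
      by (simp add: three)
    finally show ?thesis
      by (simp add: add_eq_0_iff2)
  qed
  moreover have "- b1 + - 1 * (- 1) + 1 * (- 1)^2 + a4 * (- 1)^3 \<noteq> 0"
  proof
    assume "- b1 + - 1 * (- 1) + 1 * (- 1)^2 + a4 * (- 1)^3 = 0"
    then have "b1 = 3 - a4 - 1"
      by (simp add: algebra_simps)
    with False three show False
      by simp
  qed
  ultimately have "- 1 + 2 * 1 * t + 3 * a4 * t^2 \<noteq> 0"
    if "- b1 + - 1 * t + 1 * t^2 + a4 * t^3 = 0" for t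
    using that by blast
  with False show ?thesis
    using card_projective_roots_separable[OF quadratic cubic, of 1 a4 "- b1" "- 1"] by auto
qed

section \<open>Normal forms in characteristic 3\<close>

text \<open>The parameters are the traces of right multiplication by $e_1$, $e_2$ and of left
  multiplication by $e_1$, $e_2$, in this order.\<close>

definition has_traces ::
  "('a::field \<Rightarrow> 'v::ab_group_add \<Rightarrow> 'v) \<Rightarrow> ('v \<Rightarrow> 'v \<Rightarrow> 'v) \<Rightarrow> 'a \<Rightarrow> 'a \<Rightarrow> 'a \<Rightarrow> 'a \<Rightarrow> bool" where
  "has_traces smul mul x1 x2 y1 y2 \<longleftrightarrow>
     (\<exists>a1 a4 b1 b4. isomorphic_to_msc smul mul
        (msc a1 (x2 - b4) (y2 - b4) a4 b1 (y1 - a1) (x1 - a1) b4))"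

lemma has_tracesI:
  assumes "isomorphic_to_msc smul mul (msc a1 a2 a3 a4 b1 b2 b3 b4)"
    and "x1 = a1 + b3" "x2 = a2 + b4" "y1 = a1 + b2" "y2 = a3 + b4"
  shows "has_traces smul mul x1 x2 y1 y2"
  using assms unfolding has_traces_def by (metis add_diff_cancel_left' add_diff_cancel_right')

text \<open>Traces of multiplications are linear in the multiplying vector, so
  \<open>(x1, x2)\<close> and \<open>(y1, y2)\<close> change like the coordinates of linear
  forms.\<close>

lemma has_traces_scale:
  assumes "has_traces smul mul x1 x2 y1 y2" and "c \<noteq> 0" "d \<noteq> 0"
  shows "has_traces smul mul (c * x1) (d * x2) (c * y1) (d * y2)"
proof -
  obtain a1 a4 b1 b4 where
      I: "isomorphic_to_msc smul mul (msc a1 (x2 - b4) (y2 - b4) a4 b1 (y1 - a1) (x1 - a1) b4)"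
    using assms(1) unfolding has_traces_def by blast
  show ?thesis
    by (rule has_tracesI[OF isomorphic_to_msc_scale[OF I assms(2,3)]])
      (simp_all add: algebra_simps)
qed

lemma has_traces_shift:
  assumes "has_traces smul mul x1 x2 y1 y2"
  shows "has_traces smul mul (x1 + k * x2) x2 (y1 + k * y2) y2"
proof -
  obtain a1 a4 b1 b4 where
      I: "isomorphic_to_msc smul mul (msc a1 (x2 - b4) (y2 - b4) a4 b1 (y1 - a1) (x1 - a1) b4)"
    using assms unfolding has_traces_def by blast
  show ?thesis
    by (rule has_tracesI[OF isomorphic_to_msc_shift[OF I, of k]])
      (simp_all add: algebra_simps power2_eq_square)
qed

lemma has_traces_swap:
  assumes "has_traces smul mul x1 x2 y1 y2"
  shows "has_traces smul mul x2 x1 y2 y1"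
proof -
  obtain a1 a4 b1 b4 where
      I: "isomorphic_to_msc smul mul (msc a1 (x2 - b4) (y2 - b4) a4 b1 (y1 - a1) (x1 - a1) b4)"
    using assms unfolding has_traces_def by blast
  show ?thesis
    by (rule has_tracesI[OF isomorphic_to_msc_swap[OF I]]) simp_all
qed

section \<open>Pairs of linear forms on the plane up to a change of basis\<close>

lemma has_traces_normalize_first:
  assumes T: "has_traces smul mul x1 x2 y1 y2" and "x1 \<noteq> 0 \<or> x2 \<noteq> 0"
  shows "\<exists>y1 y2. has_traces smul mul 1 0 y1 y2"
proof (cases "x2 = 0")
  case True
  with assms has_traces_scale[OF T, of "1 / x1" 1] show ?thesis
    by auto
next
  case False
  have "has_traces smul mul x2 0 y2 (y1 + - x1 / x2 * y2)"
    using has_traces_swap[OF has_traces_shift[OF T, of "- x1 / x2"]] False by simp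
  from has_traces_scale[OF this, of "1 / x2" 1] False show ?thesis
    by auto
qed

lemma has_traces_normalize_second:
  assumes T: "has_traces smul mul 0 0 y1 y2" and "y1 \<noteq> 0 \<or> y2 \<noteq> 0"
  shows "has_traces smul mul 0 0 1 0"
proof (cases "y2 = 0")
  case True
  with assms has_traces_scale[OF T, of "1 / y1" 1] show ?thesis
    by auto
next
  case False
  have "has_traces smul mul 0 0 y2 0"
    using has_traces_swap[OF has_traces_shift[OF T, of "- y1 / y2"]] False by simp
  from has_traces_scale[OF this, of "1 / y2" 1] False show ?thesis
    by auto
qed

lemma has_traces_normalize:
  assumes T: "has_traces smul mul x1 x2 y1 y2"
  shows "has_traces smul mul 1 0 0 1 \<or> (\<exists>y. has_traces smul mul 1 0 y 0) \<or>
    has_traces smul mul 0 0 1 0 \<or> has_traces smul mul 0 0 0 0"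
proof (cases "x1 = 0 \<and> x2 = 0")
  case True
  with T has_traces_normalize_second[of smul mul y1 y2] show ?thesis
    by auto
next
  case False
  then obtain y1 y2 where T: "has_traces smul mul 1 0 y1 y2"
    using has_traces_normalize_first[OF T] by auto
  show ?thesis
  proof (cases "y2 = 0")
    case True
    with T show ?thesis by blast
  next
    case False
    \<comment> \<open>Both rescaling \<open>e2\<close> and the following shift leave the first form
      alone, because it vanishes on \<open>e2\<close>.\<close>
    then have "has_traces smul mul 1 0 y1 1"
      using has_traces_scale[OF T, of 1 "1 / y2"] by simp
    from has_traces_shift[OF this, of "- y1"] show ?thesis
      by simp
  qed
qed

text \<open>Both multiplications by $e_2$ have trace zero in the reductions below, while right and left
  multiplication by $e_1$ have traces \<open>x\<close> and \<open>y\<close>. Changing $e_1$ to $e_1 + k e_2$ preserves this.\<close>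

lemma isomorphic_to_msc_reduce_regular:
  fixes x y :: "'a::field"
  assumes quadratic: "\<forall>p :: 'a poly. degree p = 2 \<longrightarrow> (\<exists>x. poly p x = 0)"
    and I: "isomorphic_to_msc smul mul (msc a1 a2 a2 a4 b1 (y - a1) (x - a1) (- a2))"
    and "a4 \<noteq> 0"
  shows "\<exists>a b. isomorphic_to_msc smul mul (msc a 0 0 1 b (y - a) (x - a) 0)"
proof -
  \<comment> \<open>A square root of \<open>1 / a4\<close>: rescaling \<open>e2\<close> by it turns
    \<open>a4\<close> into 1. A shift then adds \<open>k\<close> to \<open>a2\<close>, so
    \<open>k = - (d * a2)\<close> clears it.\<close>
  obtain d where "poly [:- 1 / a4, 0, 1:] d = 0"
    using quadratic[rule_format, of "[:- 1 / a4, 0, 1:]"] by auto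
  then have d: "d^2 * a4 = 1"
    using \<open>a4 \<noteq> 0\<close> by (simp add: power2_eq_square field_simps)
  then have "d \<noteq> 0"
    by auto
  with isomorphic_to_msc_scale[OF I, of 1 d] d
  have "isomorphic_to_msc smul mul
      (msc a1 (d * a2) (d * a2) 1 (b1 / d) (y - a1) (x - a1) (- (d * a2)))"
    by simp
  from isomorphic_to_msc_shift[OF this, of "- (d * a2)"] obtain b where
    "isomorphic_to_msc smul mul (msc (a1 - (d * a2)^2) 0 0 1 b
      (y - (a1 - (d * a2)^2)) (x - (a1 - (d * a2)^2)) 0)"
    by (simp add: algebra_simps power2_eq_square)
  then show ?thesis
    by blast
qed

text \<open>Once \<open>a2\<close> is scaled to 1, a shift by \<open>k\<close> adds
  \<open>2 * k\<close> to \<open>a1\<close>. The choice \<open>k = a1\<close> yields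
  \<open>3 * a1 = 0\<close>, and the other entries in the second row likewise lose
  \<open>3 * a1\<close>.\<close>

lemma isomorphic_to_msc_reduce_singular:
  fixes x y :: "'a::field"
  assumes three: "(3::'a) = 0"
    and I: "isomorphic_to_msc smul mul (msc a1 a2 a2 0 b1 (y - a1) (x - a1) (- a2))"
    and "a2 \<noteq> 0"
  shows "\<exists>b. isomorphic_to_msc smul mul (msc 0 1 1 0 b y x (- 1))"
proof -
  from isomorphic_to_msc_scale[OF I, of 1 "1 / a2"] \<open>a2 \<noteq> 0\<close>
  have J: "isomorphic_to_msc smul mul (msc a1 1 1 0 (a2 * b1) (y - a1) (x - a1) (- 1))"
    by simp
  have "a1 + a1 * (1 + 1) = 3 * a1"
    by algebra
  then have a1: "a1 + a1 * (1 + 1) = 0"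
    using three by simp
  have "y - a1 - a1 - a1 = y - 3 * a1" "x - a1 - a1 - a1 = x - 3 * a1"
    by algebra+
  then have xy: "y - a1 - a1 - a1 = y" "x - a1 - a1 - a1 = x"
    using three by simp_all
  from isomorphic_to_msc_shift[OF J, of a1] show ?thesis
    using a1 xy by auto
qed

lemma ex_msc_of_traces:
  assumes "has_traces smul mul x 0 y 0"
  shows "\<exists>a1 a2 a4 b1. isomorphic_to_msc smul mul (msc a1 a2 a2 a4 b1 (y - a1) (x - a1) (- a2))"
  using assms unfolding has_traces_def by (metis diff_0 minus_minus)

section \<open>The families belonging to each normal form of the traces\<close>

lemma family_independent_traces:
  assumes "has_traces smul mul 1 0 0 1"
  shows "\<exists>a1 a2 a4 b1. isomorphic_to_msc smul mul (A1_3 a1 a2 a4 b1)"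
proof -
  obtain a1 a4 b1 b4 where
    "isomorphic_to_msc smul mul (msc a1 (0 - b4) (1 - b4) a4 b1 (0 - a1) (1 - a1) b4)"
    using assms unfolding has_traces_def by blast
  then have "isomorphic_to_msc smul mul (A1_3 a1 (- b4) a4 b1)"
    by (simp add: A1_3_def)
  then show ?thesis
    by blast
qed

text \<open>The shift $e_1 \mapsto e_1 + k e_2$ changes $\beta_1$ by $k(x + y)$ because $3\alpha_1 = 0$.\<close>

lemma isomorphic_to_msc_shift_diagonal:
  fixes x y :: "'a::field"
  assumes three: "(3::'a) = 0"
    and I: "isomorphic_to_msc smul mul (msc a 0 0 0 b (y - a) (x - a) 0)"
    and "x + y \<noteq> 0"
  shows "isomorphic_to_msc smul mul (msc a 0 0 0 0 (y - a) (x - a) 0)"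
proof -
  define k where "k = - b / (x + y)"
  have "k * (x + y) = - b"
    using \<open>x + y \<noteq> 0\<close> by (simp add: k_def)
  then have "b + k * (y - a + (x - a)) - k * a = - (3 * (k * a))"
    by algebra
  then show ?thesis
    using isomorphic_to_msc_shift[OF I, of k] three by simp
qed

lemma families_first_trace:
  fixes y :: "'a::field"
  assumes three: "(3::'a) = 0"
    and quadratic: "\<forall>p :: 'a poly. degree p = 2 \<longrightarrow> (\<exists>x. poly p x = 0)"
    and T: "has_traces smul mul 1 0 y 0"
  shows "(\<exists>a1 b1 b2. isomorphic_to_msc smul mul (A2_3 a1 b1 b2)) \<or>
    (\<exists>b1 b2. isomorphic_to_msc smul mul (A3_3 b1 b2)) \<or>
    (\<exists>a1 b2. isomorphic_to_msc smul mul (A4_3 a1 b2)) \<or>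
    (\<exists>a1. isomorphic_to_msc smul mul (A5_3 a1))"
proof -
  obtain a1 a2 a4 b1 where
      I: "isomorphic_to_msc smul mul (msc a1 a2 a2 a4 b1 (y - a1) (1 - a1) (- a2))"
    using ex_msc_of_traces[OF T] by blast
  \<comment> \<open>With \<open>a4 = a2 = 0\<close> a shift moves \<open>b1\<close> by a multiple of
    \<open>1 + y\<close>. If that sum is zero, a nonzero \<open>b1\<close> can only be rescaled,
    which is the origin of \<open>A5_3\<close>.\<close>
  consider "a4 \<noteq> 0" | "a4 = 0" "a2 \<noteq> 0" | "a4 = 0" "a2 = 0" "1 + y \<noteq> 0 \<or> b1 = 0"
    | "a4 = 0" "a2 = 0" "1 + y = 0" "b1 \<noteq> 0"
    by blast
  then show ?thesis
  proof cases
    case 1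
    with isomorphic_to_msc_reduce_regular[OF quadratic I] show ?thesis
      unfolding A2_3_def by blast
  next
    case 2
    with isomorphic_to_msc_reduce_singular[OF three, of smul mul a1 a2 b1 y 1] I show ?thesis
      unfolding A3_3_def by blast
  next
    case 3
    with I isomorphic_to_msc_shift_diagonal[OF three, of smul mul a1 b1 y 1]
    have "isomorphic_to_msc smul mul (A4_3 a1 (y - a1))"
      unfolding A4_3_def by auto
    then show ?thesis
      by blast
  next
    case 4
    then have "y = - 1"
      by (simp add: add_eq_0_iff)
    with isomorphic_to_msc_scale[OF I, of 1 b1] 4
    have "isomorphic_to_msc smul mul (A5_3 a1)"
      unfolding A5_3_def by simp
    then show ?thesis
      by blast
  qed
qed

text \<open>The two traces at \<open>e1\<close> add up to 1, so a shift always removes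
  \<open>b1\<close> in the last case and no analogue of \<open>A5_3\<close> arises.\<close>

lemma families_second_trace:
  fixes smul :: "'a::field \<Rightarrow> 'v::ab_group_add \<Rightarrow> 'v"
  assumes three: "(3::'a) = 0"
    and quadratic: "\<forall>p :: 'a poly. degree p = 2 \<longrightarrow> (\<exists>x. poly p x = 0)"
    and T: "has_traces smul mul 0 0 1 0"
  shows "(\<exists>a1 b1. isomorphic_to_msc smul mul (A6_3 a1 b1)) \<or>
    (\<exists>b1. isomorphic_to_msc smul mul (A7_3 b1)) \<or>
    (\<exists>a1. isomorphic_to_msc smul mul (A8_3 a1))"
proof -
  obtain a1 a2 a4 b1 where
      I: "isomorphic_to_msc smul mul (msc a1 a2 a2 a4 b1 (1 - a1) (0 - a1) (- a2))"
    using ex_msc_of_traces[OF T] by blast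
  consider "a4 \<noteq> 0" | "a4 = 0" "a2 \<noteq> 0" | "a4 = 0" "a2 = 0"
    by blast
  then show ?thesis
  proof cases
    case 1
    with isomorphic_to_msc_reduce_regular[OF quadratic I] show ?thesis
      unfolding A6_3_def by simp
  next
    case 2
    with isomorphic_to_msc_reduce_singular[OF three, of smul mul a1 a2 b1 1 0] I show ?thesis
      unfolding A7_3_def by simp
  next
    case 3
    with I isomorphic_to_msc_shift_diagonal[OF three, of smul mul a1 b1 1 0]
    have "isomorphic_to_msc smul mul (A8_3 a1)"
      unfolding A8_3_def by simp
    then show ?thesis
      by blast
  qed
qed

lemma families_no_trace_singular:
  fixes smul :: "'a::field \<Rightarrow> 'v::ab_group_add \<Rightarrow> 'v"
  assumes three: "(3::'a) = 0"
    and quadratic: "\<forall>p :: 'a poly. degree p = 2 \<longrightarrow> (\<exists>x. poly p x = 0)"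
    and nontriv: "nontrivial_algebra mul"
    and I: "isomorphic_to_msc smul mul (msc a1 a2 a2 0 b1 (- a1) (- a1) (- a2))"
  shows "isomorphic_to_msc smul mul A9_3 \<or> isomorphic_to_msc smul mul A10_3 \<or>
    isomorphic_to_msc smul mul A11_3 \<or> isomorphic_to_msc smul mul A12_3"
proof (cases "a2 = 0")
  case False
  with isomorphic_to_msc_reduce_singular[OF three, of smul mul a1 a2 b1 0 0] I
  obtain b where J: "isomorphic_to_msc smul mul (msc 0 1 1 0 b 0 0 (- 1))"
    by auto
  show ?thesis
  proof (cases "b = 0")
    case True
    with J show ?thesis
      unfolding A10_3_def by simp
  next
    case False
    obtain c where "poly [:- 1 / b, 0, 1:] c = 0"
      using quadratic[rule_format, of "[:- 1 / b, 0, 1:]"] by auto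
    with False have c: "c^2 * b = 1"
      by (simp add: power2_eq_square field_simps)
    then have "c \<noteq> 0"
      by auto
    with isomorphic_to_msc_scale[OF J, of c 1] c show ?thesis
      unfolding A9_3_def by simp
  qed
next
  case a2: True
  consider "b1 = 0" "a1 = 0" | "b1 = 0" "a1 \<noteq> 0" | "b1 \<noteq> 0" "a1 = 0" | "b1 \<noteq> 0" "a1 \<noteq> 0"
    by blast
  then show ?thesis
  proof cases
    case 1
    obtain f where f: "Vector_Spaces.linear smul (*s) f" "bij f"
        "\<And>u v. f (mul u v) = msc_mult (msc 0 0 0 0 0 0 0 0) (f u) (f v)"
      using I 1 a2 unfolding isomorphic_to_msc_def algebra_isomorphic_def by auto
    \<comment> \<open>All structure constants vanish, which contradicts nontriviality.\<close>
    have "f (mul u v) = f (mul 0 0)" for u v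
      by (simp add: f(3) vec_eq_iff forall_2 msc_mult_component)
    then have eq: "mul u v = mul 0 0" for u v
      using f(2) by (metis bij_pointE)
    have "f (mul 0 0) = 0"
      by (simp add: f(3) vec_eq_iff forall_2 msc_mult_component)
    moreover have "f 0 = 0"
      using f(1) by (simp add: Vector_Spaces.linear.axioms module_hom.zero
          Vector_Spaces.linear_iff_module_hom)
    ultimately have "mul 0 0 = 0"
      using f(2) by (metis bij_pointE)
    with eq nontriv show ?thesis
      by (metis nontrivial_algebra_def)
  next
    case 2
    \<comment> \<open>Interchanging the basis vectors moves \<open>a1\<close> to \<open>b4\<close>
      and \<open>- a1\<close> to \<open>a2\<close> and \<open>a3\<close>; the factor brings these to
      \<open>- 1\<close> and 1.\<close>
    with isomorphic_to_msc_scale[OF isomorphic_to_msc_swap[OF I], of 1 "- (1 / a1)"] a2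
    show ?thesis
      unfolding A10_3_def by simp
  next
    case 3
    with isomorphic_to_msc_scale[OF I, of 1 b1] a2 show ?thesis
      unfolding A12_3_def by simp
  next
    case 4
    with isomorphic_to_msc_scale[OF I, of "1 / a1" "b1 / a1^2"] a2 show ?thesis
      unfolding A11_3_def by (simp add: power_divide)
  qed
qed

lemma families_no_trace:
  fixes smul :: "'a::field \<Rightarrow> 'v::ab_group_add \<Rightarrow> 'v"
  assumes three: "(3::'a) = 0"
    and quadratic: "\<forall>p :: 'a poly. degree p = 2 \<longrightarrow> (\<exists>x. poly p x = 0)"
    and cubic: "\<forall>p :: 'a poly. degree p = 3 \<longrightarrow> (\<exists>x. poly p x = 0)"
    and nontriv: "nontrivial_algebra mul"
    and T: "has_traces smul mul 0 0 0 0"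
  shows "isomorphic_to_msc smul mul A9_3 \<or> isomorphic_to_msc smul mul A10_3 \<or>
    isomorphic_to_msc smul mul A11_3 \<or> isomorphic_to_msc smul mul A12_3"
proof -
  obtain a1 a2 a4 b1 where
      I: "isomorphic_to_msc smul mul (msc a1 a2 a2 a4 b1 (0 - a1) (0 - a1) (- a2))"
    using ex_msc_of_traces[OF T] by blast
  show ?thesis
  proof (cases "a4 = 0")
    case True
    with I families_no_trace_singular[OF three quadratic nontriv] show ?thesis
      by simp
  next
    case False
    obtain a b where J: "isomorphic_to_msc smul mul (msc a 0 0 1 b (0 - a) (0 - a) 0)"
      using isomorphic_to_msc_reduce_regular[OF quadratic I False] by blast
    \<comment> \<open>With zero traces the cubic form is \<open>t^3 - b\<close>, so
      \<open>e1 + k * e2\<close> spans the only subalgebra. Interchanging the basis vectors puts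
      this line in place of \<open>e2\<close>, which gives \<open>a4 = 0\<close>, the singular
      case.\<close>
    obtain k where "poly [:- b, 0, 0, 1:] k = 0"
      using cubic[rule_format, of "[:- b, 0, 0, 1:]"] by auto
    then have b: "b = k^3"
      by (simp add: power3_eq_cube mult.assoc)
    have "b + k * (0 - a + (0 - a)) - k * (a + k^2) = - (3 * (k * a))"
      unfolding b by algebra
    with isomorphic_to_msc_shift[OF J, of k] three
    have "isomorphic_to_msc smul mul (msc (a + k^2) k k 1 0 (- (a + k^2)) (- (a + k^2)) (- k))"
      by (simp add: power2_eq_square)
    from isomorphic_to_msc_swap[OF this]
      families_no_trace_singular[OF three quadratic nontriv, of smul "- k" "- (a + k^2)" 1]
    show ?thesis
      by (simp add: add.commute)
  qed
qed

lemma classification_char_3: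
  fixes smul :: "'a::field \<Rightarrow> 'v::ab_group_add \<Rightarrow> 'v"
  assumes three: "(3::'a) = 0"
    and quadratic: "\<forall>p :: 'a poly. degree p = 2 \<longrightarrow> (\<exists>x. poly p x = 0)"
    and cubic: "\<forall>p :: 'a poly. degree p = 3 \<longrightarrow> (\<exists>x. poly p x = 0)"
    and alg: "two_dim_algebra smul mul"
    and nontriv: "nontrivial_algebra mul"
  shows "(\<exists>a1 a2 a4 b1. isomorphic_to_msc smul mul (A1_3 a1 a2 a4 b1)) \<or>
    (\<exists>a1 b1 b2. isomorphic_to_msc smul mul (A2_3 a1 b1 b2)) \<or>
    (\<exists>b1 b2. isomorphic_to_msc smul mul (A3_3 b1 b2)) \<or>
    (\<exists>a1 b2. isomorphic_to_msc smul mul (A4_3 a1 b2)) \<or>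
    (\<exists>a1. isomorphic_to_msc smul mul (A5_3 a1)) \<or>
    (\<exists>a1 b1. isomorphic_to_msc smul mul (A6_3 a1 b1)) \<or>
    (\<exists>b1. isomorphic_to_msc smul mul (A7_3 b1)) \<or>
    (\<exists>a1. isomorphic_to_msc smul mul (A8_3 a1)) \<or>
    isomorphic_to_msc smul mul A9_3 \<or> isomorphic_to_msc smul mul A10_3 \<or>
    isomorphic_to_msc smul mul A11_3 \<or> isomorphic_to_msc smul mul A12_3"
proof -
  obtain x1 x2 y1 y2 where "has_traces smul mul x1 x2 y1 y2"
    using ex_isomorphic_msc[OF alg] has_tracesI by metis
  from has_traces_normalize[OF this] consider "has_traces smul mul 1 0 0 1"
    | y where "has_traces smul mul 1 0 y 0" | "has_traces smul mul 0 0 1 0"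
    | "has_traces smul mul 0 0 0 0"
    by blast
  then show ?thesis
  proof cases
    case 1
    from family_independent_traces[OF this] show ?thesis by blast
  next
    case 2
    from families_first_trace[OF three quadratic this] show ?thesis by blast
  next
    case 3
    from families_second_trace[OF three quadratic this] show ?thesis by blast
  next
    case 4
    from families_no_trace[OF three quadratic cubic nontriv this] show ?thesis by blast
  qed
qed

section \<open>Numbers of subalgebras\<close>

lemma card_subalgebras_of_families:
  fixes smul :: "'a::field \<Rightarrow> 'v::ab_group_add \<Rightarrow> 'v"
  assumes three: "(3::'a) = 0"
    and quadratic: "\<forall>p :: 'a poly. degree p = 2 \<longrightarrow> (\<exists>x. poly p x = 0)"
    and cubic: "\<forall>p :: 'a poly. degree p = 3 \<longrightarrow> (\<exists>x. poly p x = 0)"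
    and alg: "two_dim_algebra smul mul"
  defines "n \<equiv> card (one_dim_subalgebras smul mul)"
    and "infin \<equiv> infinite (one_dim_subalgebras smul mul)"
  shows "isomorphic_to_msc smul mul (A1_3 a1 a2 a4 b1) \<Longrightarrow> n = (if b1 = - a4 - 1 then 2 else 3)"
    and "isomorphic_to_msc smul mul (A2_3 a1 b1 b2) \<Longrightarrow> n = (if b2 = 2 * a1 - 1 then 1 else 3)"
    and "isomorphic_to_msc smul mul (A3_3 b1 b2) \<Longrightarrow>
      if b2 \<noteq> - 1 then n = 2 else if b1 \<noteq> 0 then n = 1 else infin"
    and "isomorphic_to_msc smul mul (A4_3 a1 b2) \<Longrightarrow> if b2 \<noteq> 2 * a1 - 1 then n = 2 else infin"
    and "isomorphic_to_msc smul mul (A5_3 a1) \<Longrightarrow> n = 1"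
    and "isomorphic_to_msc smul mul (A6_3 a1 b1) \<Longrightarrow> n = 3"
    and "isomorphic_to_msc smul mul (A7_3 b1) \<Longrightarrow> n = 2"
    and "isomorphic_to_msc smul mul (A8_3 a1) \<Longrightarrow> n = 2"
    and "isomorphic_to_msc smul mul A9_3 \<Longrightarrow> n = 1"
    and "isomorphic_to_msc smul mul A10_3 \<Longrightarrow> infin"
    and "isomorphic_to_msc smul mul A11_3 \<Longrightarrow> n = 1"
    and "isomorphic_to_msc smul mul A12_3 \<Longrightarrow> n = 1"
proof -
  have roots: "n = card (projective_roots c0 c1 c2 a4) \<and>
      infin = infinite (projective_roots c0 c1 c2 a4)"
    if "isomorphic_to_msc smul mul (msc a1 a2 a3 a4 b1 b2 b3 b4)"
      and "c0 = - b1" "c1 = a1 - b2 - b3" "c2 = a2 + a3 - b4"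
    for a1 a2 a3 a4 b1 b2 b3 b4 c0 c1 c2
    using subalgebras_of_msc[OF alg that(1)] that(2-) bij_betw_same_card bij_betw_finite
    unfolding n_def infin_def by metis
  note separable = card_projective_roots_separable[OF quadratic cubic]
  note linear = projective_roots_linear(1,2)[where 'a = 'a]
    projective_roots_linear(3)[OF infinite_UNIV_if_quadratic_roots[OF quadratic]]
  have triple: "3 * a = 0" "a + a + a = 0" "a + (a + a) = 0" for a :: 'a
  proof -
    show "3 * a = 0" by (simp add: three)
    moreover have "a + a + a = 3 * a" "a + (a + a) = 3 * a" by algebra+
    ultimately show "a + a + a = 0" "a + (a + a) = 0" by simp_all
  qed
  {
    assume "isomorphic_to_msc smul mul (A1_3 a1 a2 a4 b1)"
    then have "n = card (projective_roots (- b1) (- 1) 1 a4)"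
      unfolding A1_3_def using triple[of a1] triple[of a2]
      by (intro roots[THEN conjunct1]) (assumption | simp add: algebra_simps)+
    then show "n = (if b1 = - a4 - 1 then 2 else 3)"
      by (simp only: card_projective_roots_A1_3[OF three quadratic cubic])
  next
    assume "isomorphic_to_msc smul mul (A2_3 a1 b1 b2)"
    then have n: "n = card (projective_roots (- b1) (2 * a1 - 1 - b2) 0 1)"
      unfolding A2_3_def
      by (intro roots[THEN conjunct1]) (assumption | simp add: algebra_simps)+
    show "n = (if b2 = 2 * a1 - 1 then 1 else 3)"
    proof (cases "b2 = 2 * a1 - 1")
      case True
      then show ?thesis
        using n card_projective_roots_cube[OF three cubic] by simp
    next
      case False
      \<comment> \<open>In characteristic 3 the derivative of this cubic is the constant
        \<open>2 * a1 - 1 - b2\<close>, so the cubic is separable as soon as that constant is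
        nonzero.\<close>
      then show ?thesis
        using n separable[of 0 1 "- b1" "2 * a1 - 1 - b2"] by (simp add: three)
    qed
  next
    assume "isomorphic_to_msc smul mul (A3_3 b1 b2)"
    then have n: "n = card (projective_roots (- b1) (- b2 - 1) 0 0) \<and>
        infin = infinite (projective_roots (- b1) (- b2 - 1) 0 0)"
      unfolding A3_3_def using triple[of 1]
      by (intro roots) (assumption | simp add: algebra_simps)+
    have "- b2 - 1 = 0 \<longleftrightarrow> b2 = - 1"
      by (metis add.inverse_inverse diff_eq_eq add_0)
    then show "if b2 \<noteq> - 1 then n = 2 else if b1 \<noteq> 0 then n = 1 else infin"
      using n linear(1)[of "- b2 - 1" "- b1"] linear(2)[of "- b1"] linear(3) by auto
  next
    assume "isomorphic_to_msc smul mul (A4_3 a1 b2)"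
    then have n: "n = card (projective_roots 0 (2 * a1 - 1 - b2) 0 0) \<and>
        infin = infinite (projective_roots 0 (2 * a1 - 1 - b2) 0 0)"
      unfolding A4_3_def
      by (intro roots) (assumption | simp add: algebra_simps)+
    then show "if b2 \<noteq> 2 * a1 - 1 then n = 2 else infin"
      using linear(1)[of "2 * a1 - 1 - b2" 0] linear(3) by auto
  next
    assume "isomorphic_to_msc smul mul (A5_3 a1)"
    moreover have "a1 - (- 1 - a1) - (1 - a1) = 3 * a1"
      by algebra
    ultimately have "n = card (projective_roots (- 1 :: 'a) 0 0 0)"
      unfolding A5_3_def triple(1)
      by (intro roots[THEN conjunct1]) (assumption | simp)+
    then show "n = 1"
      using linear(2) by simp
  next
    assume "isomorphic_to_msc smul mul (A6_3 a1 b1)"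
    then have "n = card (projective_roots (- b1) (- 1) 0 1)"
      unfolding A6_3_def using triple[of a1]
      by (intro roots[THEN conjunct1]) (assumption | simp add: algebra_simps)+
    then show "n = 3"
      using separable[of 0 1 "- b1" "- 1"] by (simp add: three)
  next
    assume "isomorphic_to_msc smul mul (A7_3 b1)"
    then have "n = card (projective_roots (- b1) (- 1) 0 0)"
      unfolding A7_3_def using triple[of 1]
      by (intro roots[THEN conjunct1]) (assumption | simp add: algebra_simps)+
    then show "n = 2"
      using linear(1) by simp
  next
    assume "isomorphic_to_msc smul mul (A8_3 a1)"
    then have "n = card (projective_roots 0 (- 1 :: 'a) 0 0)"
      unfolding A8_3_def using triple[of a1]
      by (intro roots[THEN conjunct1]) (assumption | simp add: algebra_simps)+
    then show "n = 2"
      using linear(1) by simp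
  next
    assume "isomorphic_to_msc smul mul A9_3"
    then have "n = card (projective_roots (- 1 :: 'a) 0 0 0)"
      unfolding A9_3_def using triple[of 1]
      by (intro roots[THEN conjunct1]) (assumption | simp add: algebra_simps)+
    then show "n = 1"
      using linear(2) by simp
  next
    assume "isomorphic_to_msc smul mul A10_3"
    then have "infin = infinite (projective_roots (0::'a) 0 0 0)"
      unfolding A10_3_def using triple[of 1]
      by (intro roots[THEN conjunct2]) (assumption | simp add: algebra_simps)+
    then show "infin"
      using linear(3) by simp
  next
    assume "isomorphic_to_msc smul mul A11_3"
    then have "n = card (projective_roots (- 1 :: 'a) 0 0 0)"
      unfolding A11_3_def using triple[of 1]
      by (intro roots[THEN conjunct1]) (assumption | simp add: algebra_simps)+
    then show "n = 1"
      using linear(2) by simp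
  next
    assume "isomorphic_to_msc smul mul A12_3"
    then have "n = card (projective_roots (- 1 :: 'a) 0 0 0)"
      unfolding A12_3_def
      by (intro roots[THEN conjunct1]) (assumption | simp add: algebra_simps)+
    then show "n = 1"
      using linear(2) by simp
  }
qed

text \<open>Implications with exhaustive premises and mutually exclusive conclusions are
  equivalences. The infinite case is told apart from the others by the convention that an infinite
  set has cardinality 0.\<close>

lemma determined_by_exhaustive_cases:
  fixes n :: nat
  assumes "P1 \<Longrightarrow> n = 1" "P2 \<Longrightarrow> n = 2" "P3 \<Longrightarrow> n = 3" "Q \<Longrightarrow> infin" "infin \<Longrightarrow> n = 0"
    and "P1 \<or> P2 \<or> P3 \<or> Q"
  shows "(n = 1 \<or> n = 2 \<or> n = 3 \<or> infin) \<and> (n = 1 \<longleftrightarrow> P1) \<and> (n = 2 \<longleftrightarrow> P2) \<and>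
    (n = 3 \<longleftrightarrow> P3) \<and> (infin \<longleftrightarrow> Q)"
  using assms by auto

theorem theorem3p5:
  fixes smul :: "'a::field \<Rightarrow> 'v::ab_group_add \<Rightarrow> 'v"
    and mul :: "'v \<Rightarrow> 'v \<Rightarrow> 'v"
  assumes char: "CHAR('a) = 3"
    and quadratic: "\<And>p :: 'a poly. degree p = 2 \<Longrightarrow> \<exists>x. poly p x = 0"
    and cubic: "\<And>p :: 'a poly. degree p = 3 \<Longrightarrow> \<exists>x. poly p x = 0"
    and alg: "two_dim_algebra smul mul"
    and nontriv: "nontrivial_algebra mul"
  shows
    "(card (one_dim_subalgebras smul mul) = 1 \<or> card (one_dim_subalgebras smul mul) = 2 \<or>
     card (one_dim_subalgebras smul mul) = 3 \<or> infinite (one_dim_subalgebras smul mul)) \<and>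
    (card (one_dim_subalgebras smul mul) = 1 \<longleftrightarrow>
       (\<exists>a1 b1. isomorphic_to_msc smul mul (A2_3 a1 b1 (2 * a1 - 1))) \<or>
       (\<exists>b1. b1 \<noteq> 0 \<and> isomorphic_to_msc smul mul (A3_3 b1 (- 1))) \<or>
       (\<exists>a1. isomorphic_to_msc smul mul (A5_3 a1)) \<or>
       isomorphic_to_msc smul mul A9_3 \<or>
       isomorphic_to_msc smul mul A11_3 \<or>
       isomorphic_to_msc smul mul A12_3) \<and>
    (card (one_dim_subalgebras smul mul) = 2 \<longleftrightarrow>
       (\<exists>a1 a2 a4. isomorphic_to_msc smul mul (A1_3 a1 a2 a4 (- a4 - 1))) \<or>
       (\<exists>b1 b2. b2 \<noteq> - 1 \<and> isomorphic_to_msc smul mul (A3_3 b1 b2)) \<or>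
       (\<exists>a1 b2. 2 * a1 - b2 - 1 \<noteq> 0 \<and> isomorphic_to_msc smul mul (A4_3 a1 b2)) \<or>
       (\<exists>b1. isomorphic_to_msc smul mul (A7_3 b1)) \<or>
       (\<exists>a1. isomorphic_to_msc smul mul (A8_3 a1))) \<and>
    (card (one_dim_subalgebras smul mul) = 3 \<longleftrightarrow>
       (\<exists>a1 a2 a4 b1. a4 * (b1 + a4 + 1) \<noteq> 0 \<and>
          isomorphic_to_msc smul mul (A1_3 a1 a2 a4 b1)) \<or>
       (\<exists>a1 a2 b1. b1 \<noteq> - 1 \<and> isomorphic_to_msc smul mul (A1_3 a1 a2 0 b1)) \<or>
       (\<exists>a1 b1 b2. b2 \<noteq> 2 * a1 - 1 \<and> isomorphic_to_msc smul mul (A2_3 a1 b1 b2)) \<or>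
       (\<exists>a1 b1. isomorphic_to_msc smul mul (A6_3 a1 b1))) \<and>
    (infinite (one_dim_subalgebras smul mul) \<longleftrightarrow>
       isomorphic_to_msc smul mul (A3_3 0 (- 1)) \<or>
       (\<exists>a1. isomorphic_to_msc smul mul (A4_3 a1 (2 * a1 - 1))) \<or>
       isomorphic_to_msc smul mul A10_3)"
proof -
  have "of_nat 3 = (0::'a)"
    using of_nat_CHAR[where 'a = 'a] char by simp
  then have three: "(3::'a) = 0"
    by simp
  have roots2: "\<forall>p :: 'a poly. degree p = 2 \<longrightarrow> (\<exists>x. poly p x = 0)"
    and roots3: "\<forall>p :: 'a poly. degree p = 3 \<longrightarrow> (\<exists>x. poly p x = 0)"
    using quadratic cubic by blast+
  note counts = card_subalgebras_of_families[OF three roots2 roots3 alg]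
  define I where "I = isomorphic_to_msc smul mul"
  define n where "n = card (one_dim_subalgebras smul mul)"
  define infin where "infin = infinite (one_dim_subalgebras smul mul)"
  let ?one = "(\<exists>a1 b1. I (A2_3 a1 b1 (2 * a1 - 1))) \<or> (\<exists>b1. b1 \<noteq> 0 \<and> I (A3_3 b1 (- 1))) \<or>
    (\<exists>a1. I (A5_3 a1)) \<or> I A9_3 \<or> I A11_3 \<or> I A12_3"
  let ?two = "(\<exists>a1 a2 a4. I (A1_3 a1 a2 a4 (- a4 - 1))) \<or>
    (\<exists>b1 b2. b2 \<noteq> - 1 \<and> I (A3_3 b1 b2)) \<or>
    (\<exists>a1 b2. 2 * a1 - b2 - 1 \<noteq> 0 \<and> I (A4_3 a1 b2)) \<or>
    (\<exists>b1. I (A7_3 b1)) \<or> (\<exists>a1. I (A8_3 a1))"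
  let ?three = "(\<exists>a1 a2 a4 b1. a4 * (b1 + a4 + 1) \<noteq> 0 \<and> I (A1_3 a1 a2 a4 b1)) \<or>
    (\<exists>a1 a2 b1. b1 \<noteq> - 1 \<and> I (A1_3 a1 a2 0 b1)) \<or>
    (\<exists>a1 b1 b2. b2 \<noteq> 2 * a1 - 1 \<and> I (A2_3 a1 b1 b2)) \<or> (\<exists>a1 b1. I (A6_3 a1 b1))"
  let ?infinite = "I (A3_3 0 (- 1)) \<or> (\<exists>a1. I (A4_3 a1 (2 * a1 - 1))) \<or> I A10_3"
  note counts = counts[folded I_def n_def infin_def]
  have A1: "b1 + a4 + 1 = 0 \<longleftrightarrow> b1 = - a4 - 1" and A4: "2 * a1 - b2 = 1 \<longleftrightarrow> b2 = 2 * a1 - 1"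
    for a1 a4 b1 b2 :: 'a
    by algebra+
  have one: "n = 1" if ?one
    using that by (elim disjE exE conjE) (auto dest!: counts(2,3,5,9,11,12))
  have two: "n = 2" if ?two
    using that by (elim disjE exE conjE) (auto dest!: counts(1,3,4,7,8) simp: A4)
  have n_three: "n = 3" if ?three
    using that by (elim disjE exE conjE) (auto dest!: counts(1,2,6) simp: A1)
  have infin: infin if ?infinite
    using that by (elim disjE exE conjE) (auto dest!: counts(3,4,10))
  have exhaustive: "?one \<or> ?two \<or> ?three \<or> ?infinite"
  proof -
    have f1: "?two \<or> ?three" if I: "I (A1_3 a1 a2 a4 b1)" for a1 a2 a4 b1
    proof -
      \<comment> \<open>The product condition fails for \<open>a4 = 0\<close>, so the algebras with
        three subalgebras and \<open>a4 = 0\<close> need a clause of their own.\<close>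
      consider "b1 = - a4 - 1" | "a4 = 0" "b1 \<noteq> - 1" | "a4 * (b1 + a4 + 1) \<noteq> 0"
        using A1[of b1 a4] by (cases "a4 = 0") auto
      then show ?thesis
      proof cases
        case 1
        have "I (A1_3 a1 a2 a4 (- a4 - 1))" using I unfolding 1 .
        then have "\<exists>a1 a2 a4. I (A1_3 a1 a2 a4 (- a4 - 1))" by (intro exI)
        then show ?thesis by (rule disjI1[OF disjI1])
      next
        case 2
        have "I (A1_3 a1 a2 0 b1)" using I unfolding 2 .
        with 2(2) show ?thesis by blast
      next
        case 3
        with I show ?thesis by blast
      qed
    qed
    have f2: "?one \<or> ?three" if I: "I (A2_3 a1 b1 b2)" for a1 b1 b2
    proof (cases "b2 = 2 * a1 - 1")
      case True
      have "I (A2_3 a1 b1 (2 * a1 - 1))" using I unfolding True .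
      then have "\<exists>a1 b1. I (A2_3 a1 b1 (2 * a1 - 1))" by (intro exI)
      then show ?thesis by (rule disjI1[OF disjI1])
    next
      case False
      with I show ?thesis by blast
    qed
    have f3: "?one \<or> ?two \<or> ?infinite" if I: "I (A3_3 b1 b2)" for b1 b2
    proof -
      consider "b2 \<noteq> - 1" | "b2 = - 1" "b1 \<noteq> 0" | "b2 = - 1" "b1 = 0"
        by blast
      then show ?thesis
      proof cases
        case 1
        with I show ?thesis by blast
      next
        case 2
        with I show ?thesis by blast
      next
        case 3
        show ?thesis using I unfolding 3 by blast
      qed
    qed
    have f4: "?two \<or> ?infinite" if I: "I (A4_3 a1 b2)" for a1 b2
    proof (cases "b2 = 2 * a1 - 1")
      case True
      have "I (A4_3 a1 (2 * a1 - 1))" using I unfolding True .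
      then have "\<exists>a1. I (A4_3 a1 (2 * a1 - 1))" by (intro exI)
      then show ?thesis by (rule disjI2[OF disjI2[OF disjI1]])
    next
      case False
      then have "2 * a1 - b2 - 1 \<noteq> 0" by (simp add: A4)
      with I show ?thesis by blast
    qed
    have "(\<exists>a1 a2 a4 b1. I (A1_3 a1 a2 a4 b1)) \<or> (\<exists>a1 b1 b2. I (A2_3 a1 b1 b2)) \<or>
      (\<exists>b1 b2. I (A3_3 b1 b2)) \<or> (\<exists>a1 b2. I (A4_3 a1 b2)) \<or> (\<exists>a1. I (A5_3 a1)) \<or>
      (\<exists>a1 b1. I (A6_3 a1 b1)) \<or> (\<exists>b1. I (A7_3 b1)) \<or> (\<exists>a1. I (A8_3 a1)) \<or>
      I A9_3 \<or> I A10_3 \<or> I A11_3 \<or> I A12_3"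
      unfolding I_def by (rule classification_char_3[OF three roots2 roots3 alg nontriv])
    then consider a1 a2 a4 b1 where "I (A1_3 a1 a2 a4 b1)"
      | a1 b1 b2 where "I (A2_3 a1 b1 b2)" | b1 b2 where "I (A3_3 b1 b2)"
      | a1 b2 where "I (A4_3 a1 b2)"
      | "(\<exists>a1. I (A5_3 a1)) \<or> I A9_3 \<or> I A11_3 \<or> I A12_3"
      | "(\<exists>b1. I (A7_3 b1)) \<or> (\<exists>a1. I (A8_3 a1))"
      | "\<exists>a1 b1. I (A6_3 a1 b1)" | "I A10_3"
      by (elim disjE exE) blast+
    then show ?thesis
    proof cases
      case 1
      from f1[OF this] show ?thesis by blast
    next
      case 2
      from f2[OF this] show ?thesis by blast
    next
      case 3
      from f3[OF this] show ?thesis by blast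
    next
      case 4
      from f4[OF this] show ?thesis by blast
    qed blast+
  qed
  have "infin \<Longrightarrow> n = 0"
    by (simp add: infin_def n_def)
  from determined_by_exhaustive_cases[OF one two n_three infin this exhaustive]
  have "(n = 1 \<or> n = 2 \<or> n = 3 \<or> infin) \<and> (n = 1 \<longleftrightarrow> ?one) \<and> (n = 2 \<longleftrightarrow> ?two) \<and>
      (n = 3 \<longleftrightarrow> ?three) \<and> (infin \<longleftrightarrow> ?infinite)" .
  then show ?thesis
    unfolding I_def n_def infin_def .
qed

end
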